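(* Assume the convex vector optimization problem (P) satisfies: (a) the feasible region $\mathcal{X}$ is a compact subset of $\mathbb{R}^n$; (b) $\mathcal{X}$ has non-empty interior; (c) $\Gamma:X\to\mathbb{R}^q$ is continuous; (d) the ordering cone $C$ is polyhedral and $D=\mathbb{R}^m_+$. Let $\epsilon>0$. Then the Primal Approximation Algorithm (described in the context, with or without the optional break) works correctly: if the algorithm terminates, it returns a finite weak $\epsilon$-solution $\bar{\mathcal{X}}$ to (P) and a finite $\epsilon$-solution $\bar{\mathcal{T}}$ to the geometric dual problem (GD).
   Context: Problem (P). $C\subseteq\mathbb{R}^q$ is a polyhedral convex cone that is non-trivial ($\{0\}\subsetneq C\subsetneq\mathbb{R}^q$), pointed (contains no line) and has nonempty interior; $v\le_C w$ means $w-v\in C$; $X\subseteq\mathbb{R}^n$ is convex; $\Gamma:X\to\mathbb{R}^q$ is $C$-convex, i.e. $\Gamma(\alpha x+(1-\alpha)y)\le_C\alpha\Gamma(x)+(1-\alpha)\Gamma(y)$ for $x,y\in X$, $\alpha\in[0,1]$; with $D=\mathbb{R}^m_+$, $g:X\to\mathbb{R}^m$ is componentwise convex. (P) is: minimize $\Gamma(x)$ with respect to $\le_C$ subject to $x\in\mathcal{X}:=\{x\in X: g(x)\le 0\}$, and $\mathcal{X}\neq\emptyset$. Upper image: $\mathcal{P}:=\operatorname{cl}(\Gamma(\mathcal{X})+C)$. Dual cone: $C^+:=\{z\in\mathbb{R}^q:\ z^\top y\ge0\ \forall y\in C\}$. (Under (a)–(d), (P) is bounded: $\mathcal{P}\subseteq\{y\}+C$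 for some $y\in\mathbb{R}^q$.) Fixed data. $c\in\operatorname{int}C$ and $c^1,\dots,c^{q-1}\in\mathbb{R}^q$ are fixed such that $c^1,\dots,c^{q-1},c$ are linearly independent; $T:=(c^1,\dots,c^{q-1},c)$ is the nonsingular matrix with these columns. For $t\in\mathbb{R}^q$, $w(t):=\big((t_1,\dots,t_{q-1},1)T^{-1}\big)^\top$. For $y,y^*\in\mathbb{R}^q$, $\varphi(y,y^* ):=(y^*_1,\dots,y^*_{q-1},1)T^{-1}y-y^*_q$. Geometric dual (GD). $K:=\{(0,\dots,0,s)^\top: s\ge0\}=\mathbb{R}_+e^q$, with $e^q$ the last unit vector of $\mathbb{R}^q$. (GD) is: maximize $D^*(t):=(t_1,\dots,t_{q-1},\inf_{x\in\mathcal{X}}w(t)^\top\Gamma(x))^\top$ with respect to $\le_K$ over $t\in\mathcal{T}:=\{t\in\mathbb{R}^q:w(t)\in C^+\}$. Lower image: $\mathcal{D}:=\{t\in\mathbb{R}^q: w(t)\in C^+,\ t_q\le\inf_{x\in\mathcal{X}}w(t)^\top\Gamma(x)\}$. Solution concepts. $\bar x\in\mathcal{X}$ is a weak minimizer of (P) if $(\{\Gamma(\bar x)\}-\operatorname{int}C)\cap\Gamma(\mathcal{X})=\emptyset$. A finite weak $\epsilon$-solution to (P) is a nonempty finite set $\bar{\mathcal{X}}\subseteq\mathcal{X}$ of weak minimizers with $\operatorname{conv}\Gamma(\bar{\mathcal{X}})+C-\epsilon\{c\}\supseteq\mathcal{P}$. $\bar t\in\mathcal{T}$ is a maximizer of (GD)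 if there is no $t\in\mathcal{T}$ with $D^*(t)\ge_K D^*(\bar t)$ and $D^*(t)\ne D^*(\bar t)$. A finite $\epsilon$-solution to (GD) is a nonempty finite set $\bar{\mathcal{T}}\subseteq\mathcal{T}$ of maximizers with $\operatorname{conv}D^*(\bar{\mathcal{T}})-K+\epsilon\{e^q\}\supseteq\mathcal{D}$. Scalar problems. $z^1,\dots,z^J$ are generating vectors of $C^+$ normalized by $c^\top z^j=1$, $Z$ is the matrix with columns $z^1,\dots,z^J$, and $Y$ is the matrix whose columns are generating vectors of $C$. P$_1(w)$: $\min\{w^\top\Gamma(x): x\in X,\ g(x)\le0\}$. P$_2(v)$: $\min\{z\in\mathbb{R}: x\in X,\ g(x)\le0,\ Z^\top(\Gamma(x)-zc-v)\le0\}$ (variables $(x,z)$). D$_2(v)$: $\max\{\inf_{x\in X}\{u^\top g(x)+w^\top\Gamma(x)\}-w^\top v:\ u\in\mathbb{R}^m,\ u\ge0,\ w\in\mathbb{R}^q,\ w^\top c=1,\ Y^\top w\ge0\}$ (variables $(u,w)$). Primal Approximation Algorithm (input $\epsilon>0$). Initialization: for $j=1,\dots,J$ compute an optimal solution $x^j$ of P$_1(z^j)$; set $\mathcal{P}_0:=\bigcap_{j=1}^J\{y\in\mathbb{R}^q:(z^j)^\top y\ge(z^j)^\top\Gamma(x^j)\}$, $k:=0$, $\bar{\mathcal{X}}:=\{x^1,\dots,x^J\}$, $\bar{\mathcal{T}}:=\{T^\top z^1,\dots,T^\top z^J\}$. Repeat: set $M:=\mathbb{R}^q$ and compute the set of vertices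 of the polyhedron $\mathcal{P}_k$. Go through the vertices $v$ one after the other; for each, compute optimal solutions $(x^v,z^v)$ of P$_2(v)$ and $(u^v,w^v)$ of D$_2(v)$; add $x^v$ to $\bar{\mathcal{X}}$ and $T^\top w^v$ to $\bar{\mathcal{T}}$; if $z^v>\epsilon$, replace $M$ by $M\cap\{y\in\mathbb{R}^q:\varphi(y,D^*(T^\top w^v))\ge0\}$ and (optional break) stop going through the vertices. Afterwards, if $M\ne\mathbb{R}^q$, set $\mathcal{P}_{k+1}:=\mathcal{P}_k\cap M$, increase $k$ by one and repeat; if $M=\mathbb{R}^q$, terminate and return $\bar{\mathcal{X}}$ and $\bar{\mathcal{T}}$. *)

theory Defs
  imports "HOL-Analysis.Analysis"
begin

subsection \<open>Ordering cones\<close>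

definition le_cone :: "(real^'q) set \<Rightarrow> real^'q \<Rightarrow> real^'q \<Rightarrow> bool" where
  "le_cone C v w \<longleftrightarrow> w - v \<in> C"

definition contains_line :: "(real^'q) set \<Rightarrow> bool" where
  "contains_line S \<longleftrightarrow> (\<exists>a d. d \<noteq> 0 \<and> (\<forall>r. a + r *\<^sub>R d \<in> S))"

definition dual_cone :: "(real^'q) set \<Rightarrow> (real^'q) set" where
  "dual_cone C = {z. \<forall>y\<in>C. 0 \<le> z \<bullet> y}"

definition cone_convex_on ::
    "(real^'q) set \<Rightarrow> (real^'n) set \<Rightarrow> (real^'n \<Rightarrow> real^'q) \<Rightarrow> bool" where
  "cone_convex_on C X \<Gamma> \<longleftrightarrow>
     (\<forall>x\<in>X. \<forall>y\<in>X. \<forall>\<alpha>\<in>{0..1}.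
        le_cone C (\<Gamma> (\<alpha> *\<^sub>R x + (1 - \<alpha>) *\<^sub>R y)) (\<alpha> *\<^sub>R \<Gamma> x + (1 - \<alpha>) *\<^sub>R \<Gamma> y))"

definition columns_generate :: "real^'j^'q \<Rightarrow> (real^'q) set \<Rightarrow> bool" where
  "columns_generate A C \<longleftrightarrow> C = {A *v l |l. 0 \<le> l}"


subsection \<open>The convex vector optimization problem\<close>

definition feasible_set :: "(real^'n) set \<Rightarrow> (real^'n \<Rightarrow> real^'m) \<Rightarrow> (real^'n) set" where
  "feasible_set X g = {x \<in> X. g x \<le> 0}"

definition upper_image ::
    "(real^'q) set \<Rightarrow> (real^'n) set \<Rightarrow> (real^'n \<Rightarrow> real^'m) \<Rightarrow> (real^'n \<Rightarrow> real^'q) \<Rightarrow> (real^'q) set" where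
  "upper_image C X g \<Gamma> = closure {a + b |a b. a \<in> \<Gamma> ` feasible_set X g \<and> b \<in> C}"

definition weak_minimizer ::
    "(real^'q) set \<Rightarrow> (real^'n) set \<Rightarrow> (real^'n \<Rightarrow> real^'m) \<Rightarrow> (real^'n \<Rightarrow> real^'q) \<Rightarrow> real^'n \<Rightarrow> bool" where
  "weak_minimizer C X g \<Gamma> x \<longleftrightarrow>
     x \<in> feasible_set X g \<and> {\<Gamma> x - d |d. d \<in> interior C} \<inter> \<Gamma> ` feasible_set X g = {}"

definition finite_weak_eps_solution ::
    "(real^'q) set \<Rightarrow> real^'q \<Rightarrow> (real^'n) set \<Rightarrow> (real^'n \<Rightarrow> real^'m) \<Rightarrow> (real^'n \<Rightarrow> real^'q) \<Rightarrow>
     real \<Rightarrow> (real^'n) set \<Rightarrow> bool" where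
  "finite_weak_eps_solution C c X g \<Gamma> \<epsilon> Xb \<longleftrightarrow>
     Xb \<noteq> {} \<and> finite Xb \<and> Xb \<subseteq> feasible_set X g \<and>
     (\<forall>x\<in>Xb. weak_minimizer C X g \<Gamma> x) \<and>
     upper_image C X g \<Gamma> \<subseteq> {a + b - \<epsilon> *\<^sub>R c |a b. a \<in> convex hull (\<Gamma> ` Xb) \<and> b \<in> C}"


subsection \<open>The geometric dual problem\<close>

text \<open>The notation \<^typ>\<open>real^'q\<close> fixes the sort of \<open>'q\<close> to \<open>finite\<close>; the synonym leaves it open, so that
  an ordered index type, which has a last coordinate, can be required.\<close>

type_synonym 'q rvec = "(real, 'q) vec"

definition last_ix :: "'q::{finite,linorder}" where
  "last_ix = Max UNIV"

text \<open>\<^term>\<open>T\<close> is the matrix with columns \<open>c\<^sup>1, \<dots>, c\<^bsup>q-1\<^esup>, c\<close>.\<close>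

definition w_vec :: "('q::{finite,linorder} rvec, 'q) vec \<Rightarrow> 'q rvec \<Rightarrow> 'q rvec" where
  "w_vec T t = (\<chi> i. if i = last_ix then 1 else t $ i) v* matrix_inv T"

definition coupling :: "('q::{finite,linorder} rvec, 'q) vec \<Rightarrow> 'q rvec \<Rightarrow> 'q rvec \<Rightarrow> real" where
  "coupling T y ys = ((\<chi> i. if i = last_ix then 1 else ys $ i) v* matrix_inv T) \<bullet> y - ys $ last_ix"

definition dual_order_cone :: "'q::{finite,linorder} rvec set" where
  "dual_order_cone = {s *\<^sub>R axis last_ix 1 |s. 0 \<le> s}"

definition dual_feasible_set ::
    "'q::{finite,linorder} rvec set \<Rightarrow> ('q rvec, 'q) vec \<Rightarrow> 'q rvec set" where
  "dual_feasible_set C T = {t. w_vec T t \<in> dual_cone C}"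

text \<open>The infimum below is the one on the reals; it is only meaningful if
  \<open>w(t)\<^sup>T \<Gamma>\<close> is bounded below on the nonempty feasible set, which holds when that set is compact
  and \<open>\<Gamma>\<close> is continuous.\<close>

definition dual_objective ::
    "('q::{finite,linorder} rvec, 'q) vec \<Rightarrow> (real^'n) set \<Rightarrow> (real^'n \<Rightarrow> real^'m) \<Rightarrow> (real^'n \<Rightarrow> 'q rvec) \<Rightarrow>
     'q rvec \<Rightarrow> 'q rvec" where
  "dual_objective T X g \<Gamma> t =
     (\<chi> i. if i = last_ix then (INF x\<in>feasible_set X g. w_vec T t \<bullet> \<Gamma> x) else t $ i)"

definition lower_image ::
    "'q::{finite,linorder} rvec set \<Rightarrow> ('q rvec, 'q) vec \<Rightarrow> (real^'n) set \<Rightarrow> (real^'n \<Rightarrow> real^'m) \<Rightarrow> (real^'n \<Rightarrow> 'q rvec) \<Rightarrow>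
     'q rvec set" where
  "lower_image C T X g \<Gamma> =
     {t. w_vec T t \<in> dual_cone C \<and> t $ last_ix \<le> (INF x\<in>feasible_set X g. w_vec T t \<bullet> \<Gamma> x)}"

definition dual_maximizer ::
    "'q::{finite,linorder} rvec set \<Rightarrow> ('q rvec, 'q) vec \<Rightarrow> (real^'n) set \<Rightarrow> (real^'n \<Rightarrow> real^'m) \<Rightarrow> (real^'n \<Rightarrow> 'q rvec) \<Rightarrow>
     'q rvec \<Rightarrow> bool" where
  "dual_maximizer C T X g \<Gamma> tb \<longleftrightarrow>
     tb \<in> dual_feasible_set C T \<and>
     \<not> (\<exists>t\<in>dual_feasible_set C T.
          le_cone dual_order_cone (dual_objective T X g \<Gamma> tb) (dual_objective T X g \<Gamma> t) \<and>
          dual_objective T X g \<Gamma> t \<noteq> dual_objective T X g \<Gamma> tb)"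

definition finite_dual_eps_solution ::
    "'q::{finite,linorder} rvec set \<Rightarrow> ('q rvec, 'q) vec \<Rightarrow> (real^'n) set \<Rightarrow> (real^'n \<Rightarrow> real^'m) \<Rightarrow> (real^'n \<Rightarrow> 'q rvec) \<Rightarrow>
     real \<Rightarrow> 'q rvec set \<Rightarrow> bool" where
  "finite_dual_eps_solution C T X g \<Gamma> \<epsilon> Tb \<longleftrightarrow>
     Tb \<noteq> {} \<and> finite Tb \<and> Tb \<subseteq> dual_feasible_set C T \<and>
     (\<forall>t\<in>Tb. dual_maximizer C T X g \<Gamma> t) \<and>
     lower_image C T X g \<Gamma> \<subseteq>
       {a - b + \<epsilon> *\<^sub>R axis last_ix 1 |a b.
          a \<in> convex hull (dual_objective T X g \<Gamma> ` Tb) \<and> b \<in> dual_order_cone}"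


subsection \<open>The scalar problems\<close>

definition P1_optimal ::
    "(real^'n) set \<Rightarrow> (real^'n \<Rightarrow> real^'m) \<Rightarrow> (real^'n \<Rightarrow> real^'q) \<Rightarrow> real^'q \<Rightarrow> real^'n \<Rightarrow> bool" where
  "P1_optimal X g \<Gamma> w x \<longleftrightarrow>
     x \<in> feasible_set X g \<and> (\<forall>x'\<in>feasible_set X g. w \<bullet> \<Gamma> x \<le> w \<bullet> \<Gamma> x')"

definition P2_feasible ::
    "real^'q \<Rightarrow> real^'j^'q \<Rightarrow> (real^'n) set \<Rightarrow> (real^'n \<Rightarrow> real^'m) \<Rightarrow> (real^'n \<Rightarrow> real^'q) \<Rightarrow>
     real^'q \<Rightarrow> real^'n \<Rightarrow> real \<Rightarrow> bool" where
  "P2_feasible c Z X g \<Gamma> v x z \<longleftrightarrow>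
     x \<in> X \<and> g x \<le> 0 \<and> transpose Z *v (\<Gamma> x - z *\<^sub>R c - v) \<le> 0"

definition P2_optimal ::
    "real^'q \<Rightarrow> real^'j^'q \<Rightarrow> (real^'n) set \<Rightarrow> (real^'n \<Rightarrow> real^'m) \<Rightarrow> (real^'n \<Rightarrow> real^'q) \<Rightarrow>
     real^'q \<Rightarrow> real^'n \<Rightarrow> real \<Rightarrow> bool" where
  "P2_optimal c Z X g \<Gamma> v x z \<longleftrightarrow>
     P2_feasible c Z X g \<Gamma> v x z \<and> (\<forall>x' z'. P2_feasible c Z X g \<Gamma> v x' z' \<longrightarrow> z \<le> z')"

definition D2_feasible :: "real^'q \<Rightarrow> real^'r^'q \<Rightarrow> real^'m \<Rightarrow> real^'q \<Rightarrow> bool" where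
  "D2_feasible c Y u w \<longleftrightarrow> 0 \<le> u \<and> w \<bullet> c = 1 \<and> 0 \<le> transpose Y *v w"

text \<open>The infimum over \<^term>\<open>X\<close> (not the feasible set) may be \<open>-\<infinity>\<close>, hence extended reals.\<close>

definition D2_value ::
    "(real^'n) set \<Rightarrow> (real^'n \<Rightarrow> real^'m) \<Rightarrow> (real^'n \<Rightarrow> real^'q) \<Rightarrow>
     real^'q \<Rightarrow> real^'m \<Rightarrow> real^'q \<Rightarrow> ereal" where
  "D2_value X g \<Gamma> v u w = (INF x\<in>X. ereal (u \<bullet> g x + w \<bullet> \<Gamma> x)) - ereal (w \<bullet> v)"

definition D2_optimal ::
    "real^'q \<Rightarrow> real^'r^'q \<Rightarrow> (real^'n) set \<Rightarrow> (real^'n \<Rightarrow> real^'m) \<Rightarrow> (real^'n \<Rightarrow> real^'q) \<Rightarrow>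
     real^'q \<Rightarrow> real^'m \<Rightarrow> real^'q \<Rightarrow> bool" where
  "D2_optimal c Y X g \<Gamma> v u w \<longleftrightarrow>
     D2_feasible c Y u w \<and>
     (\<forall>u' w'. D2_feasible c Y u' w' \<longrightarrow> D2_value X g \<Gamma> v u' w' \<le> D2_value X g \<Gamma> v u w)"


subsection \<open>The Primal Approximation Algorithm\<close>

text \<open>The algorithm is nondeterministic (choice of optimal solutions, order in which vertices are
  visited) and is therefore modelled by relations. One pass through the list of vertices transforms
  the triple of \<open>M\<close>, the collected primal points and the collected dual points. The parameter
  \<open>brk\<close> tells whether the optional break is used.\<close>

inductive vertex_loop ::
    "bool \<Rightarrow> real \<Rightarrow> 'q::{finite,linorder} rvec \<Rightarrow> ('q rvec, 'q) vec \<Rightarrow> (real^'j, 'q) vec \<Rightarrow> (real^'r, 'q) vec \<Rightarrow>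
     (real^'n) set \<Rightarrow> (real^'n \<Rightarrow> real^'m) \<Rightarrow> (real^'n \<Rightarrow> 'q rvec) \<Rightarrow>
     'q rvec list \<Rightarrow>
     'q rvec set \<Rightarrow> (real^'n) set \<Rightarrow> 'q rvec set \<Rightarrow>
     'q rvec set \<Rightarrow> (real^'n) set \<Rightarrow> 'q rvec set \<Rightarrow> bool"
  for brk \<epsilon> c T Z Y X g \<Gamma> where
  all_visited:
    "vertex_loop brk \<epsilon> c T Z Y X g \<Gamma> [] M Xb Tb M Xb Tb"
| no_cut:
    "P2_optimal c Z X g \<Gamma> v x z \<Longrightarrow> D2_optimal c Y X g \<Gamma> v u w \<Longrightarrow> \<not> z > \<epsilon> \<Longrightarrow>
     vertex_loop brk \<epsilon> c T Z Y X g \<Gamma> vs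
       M (insert x Xb) (insert (transpose T *v w) Tb) M' Xb' Tb' \<Longrightarrow>
     vertex_loop brk \<epsilon> c T Z Y X g \<Gamma> (v # vs) M Xb Tb M' Xb' Tb'"
| cut_continue:
    "P2_optimal c Z X g \<Gamma> v x z \<Longrightarrow> D2_optimal c Y X g \<Gamma> v u w \<Longrightarrow> z > \<epsilon> \<Longrightarrow> \<not> brk \<Longrightarrow>
     vertex_loop brk \<epsilon> c T Z Y X g \<Gamma> vs
       (M \<inter> {y. coupling T y (dual_objective T X g \<Gamma> (transpose T *v w)) \<ge> 0})
       (insert x Xb) (insert (transpose T *v w) Tb) M' Xb' Tb' \<Longrightarrow>
     vertex_loop brk \<epsilon> c T Z Y X g \<Gamma> (v # vs) M Xb Tb M' Xb' Tb'"
| cut_break: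
    "P2_optimal c Z X g \<Gamma> v x z \<Longrightarrow> D2_optimal c Y X g \<Gamma> v u w \<Longrightarrow> z > \<epsilon> \<Longrightarrow> brk \<Longrightarrow>
     vertex_loop brk \<epsilon> c T Z Y X g \<Gamma> (v # vs) M Xb Tb
       (M \<inter> {y. coupling T y (dual_objective T X g \<Gamma> (transpose T *v w)) \<ge> 0})
       (insert x Xb) (insert (transpose T *v w) Tb)"

definition vertex_enumeration :: "(real^'q) set \<Rightarrow> (real^'q) list \<Rightarrow> bool" where
  "vertex_enumeration P vs \<longleftrightarrow> distinct vs \<and> set vs = {v. v extreme_point_of P}"

text \<open>\<open>paa_state \<dots> k P Xb Tb\<close>: some run of the algorithm enters its main loop with the counter
  \<open>k\<close>, the outer approximation \<open>P\<^sub>k = P\<close> and the collected points \<open>Xb\<close>, \<open>Tb\<close>.\<close>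

inductive paa_state ::
    "bool \<Rightarrow> real \<Rightarrow> 'q::{finite,linorder} rvec \<Rightarrow> ('q rvec, 'q) vec \<Rightarrow> (real^'j, 'q) vec \<Rightarrow> (real^'r, 'q) vec \<Rightarrow>
     (real^'n) set \<Rightarrow> (real^'n \<Rightarrow> real^'m) \<Rightarrow> (real^'n \<Rightarrow> 'q rvec) \<Rightarrow>
     nat \<Rightarrow> 'q rvec set \<Rightarrow> (real^'n) set \<Rightarrow> 'q rvec set \<Rightarrow> bool"
  for brk \<epsilon> c T Z Y X g \<Gamma> where
  init:
    "(\<And>j. P1_optimal X g \<Gamma> (column j Z) (xs j)) \<Longrightarrow>
     paa_state brk \<epsilon> c T Z Y X g \<Gamma> 0
       (\<Inter>j. {y. column j Z \<bullet> y \<ge> column j Z \<bullet> \<Gamma> (xs j)})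
       (range xs) (range (\<lambda>j. transpose T *v column j Z))"
| step:
    "paa_state brk \<epsilon> c T Z Y X g \<Gamma> k P Xb Tb \<Longrightarrow> vertex_enumeration P vs \<Longrightarrow>
     vertex_loop brk \<epsilon> c T Z Y X g \<Gamma> vs UNIV Xb Tb M Xb' Tb' \<Longrightarrow> M \<noteq> UNIV \<Longrightarrow>
     paa_state brk \<epsilon> c T Z Y X g \<Gamma> (Suc k) (P \<inter> M) Xb' Tb'"

text \<open>Some run terminates and returns \<open>Xb'\<close> and \<open>Tb'\<close>.\<close>

definition paa_returns ::
    "bool \<Rightarrow> real \<Rightarrow> 'q::{finite,linorder} rvec \<Rightarrow> ('q rvec, 'q) vec \<Rightarrow> (real^'j, 'q) vec \<Rightarrow> (real^'r, 'q) vec \<Rightarrow>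
     (real^'n) set \<Rightarrow> (real^'n \<Rightarrow> real^'m) \<Rightarrow> (real^'n \<Rightarrow> 'q rvec) \<Rightarrow>
     (real^'n) set \<Rightarrow> 'q rvec set \<Rightarrow> bool" where
  "paa_returns brk \<epsilon> c T Z Y X g \<Gamma> Xb' Tb' \<longleftrightarrow>
     (\<exists>k P Xb Tb vs M.
        paa_state brk \<epsilon> c T Z Y X g \<Gamma> k P Xb Tb \<and> vertex_enumeration P vs \<and>
        vertex_loop brk \<epsilon> c T Z Y X g \<Gamma> vs UNIV Xb Tb M Xb' Tb' \<and> M = UNIV)"

end

theory Submission
  imports Defs
begin

text \<open>
  Each outer approximation has the form \<open>P\<^sub>k = {y. p(w) \<le> w\<^sup>T y for all w \<in> W}\<close>, where
  \<open>p(w) = inf w\<^sup>T \<Gamma>\<close> over the feasible set and \<open>W\<close> is a finite set of weights in \<open>C\<^sup>+\<close> with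
  \<open>w\<^sup>T c = 1\<close> and \<open>T\<^sup>T w\<close> among the collected dual points. Hence \<open>P\<^sub>k\<close> contains the upper image, and,
  lying in a translate of the pointed cone \<open>C\<close>, it is contained in the convex hull of its vertices
  plus \<open>C\<close>. Every cut is a proper half-space, so termination means that each vertex \<open>v\<close> satisfies
  \<open>\<Gamma>(x\<^sup>v) \<le> v + \<epsilon> c\<close>; this gives the primal statement. For the dual one, a hyperplane separating
  \<open>t - \<epsilon> e\<^sup>q\<close> from \<open>conv D\<^sup>*(Tb) - K\<close> can be tilted to be non-vertical; it then is \<open>\<phi>(y, \<cdot>)\<close> for some
  point \<open>y\<close>, which has to lie in the outer approximation and contradicts the primal inclusion.
\<close>

subsection \<open>Closed convex cones\<close>

text \<open>The nontrivial half of the bipolar theorem: a functional strictly separating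
  \<open>y\<close> from \<open>C\<close> is nonnegative on the cone, so it lies in the dual cone and
  yet is negative at \<open>y\<close>.\<close>

lemma dual_cone_bipolar:
  fixes C :: "(real^'q) set"
  assumes "closed C" "convex_cone C" and y: "\<And>z. z \<in> dual_cone C \<Longrightarrow> 0 \<le> z \<bullet> y"
  shows "y \<in> C"
proof (rule ccontr)
  assume "y \<notin> C"
  moreover have "convex C"
    using assms(2) by (simp add: convex_cone_def)
  ultimately obtain a b where ab: "a \<bullet> y < b" "\<And>x. x \<in> C \<Longrightarrow> b < a \<bullet> x"
    using separating_hyperplane_closed_point[of C y] assms(1) by blast
  have "b < 0"
    using ab(2)[OF convex_cone_contains_0[OF assms(2)]] by simp
  have "0 \<le> a \<bullet> x" if "x \<in> C" for x
  proof (rule ccontr)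
    assume neg: "\<not> 0 \<le> a \<bullet> x"
    \<comment> \<open>At this multiple of \<open>x\<close> the functional \<open>a\<close> takes the
      value \<open>b\<close> itself, which strict separation excludes.\<close>
    then have "(b / (a \<bullet> x)) *\<^sub>R x \<in> C"
      using \<open>b < 0\<close> by (intro convex_cone_scaleR assms that) (simp add: divide_nonpos_nonpos)
    from ab(2)[OF this] neg show False
      by simp
  qed
  then have "a \<in> dual_cone C"
    by (simp add: dual_cone_def)
  from y[OF this] ab(1) \<open>b < 0\<close> show False
    by simp
qed

text \<open>An interior point can be moved a little along \<open>- z\<close> without leaving the
  cone, and this lowers the value of \<open>z\<close> by a positive amount.\<close>

lemma inner_interior_cone_pos:
  assumes z: "z \<in> dual_cone C" "z \<noteq> 0" and d: "d \<in> interior C"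
  shows "0 < z \<bullet> d"
proof -
  obtain e where e: "e > 0" "cball d e \<subseteq> C"
    using d mem_interior_cball by blast
  let ?y = "d - (e / norm z) *\<^sub>R z"
  have "?y \<in> C"
    using e z(2) by (intro subsetD[OF e(2)]) (simp add: dist_norm)
  then have "0 \<le> z \<bullet> ?y"
    using z(1) by (auto simp: dual_cone_def)
  also have "z \<bullet> ?y = z \<bullet> d - e * norm z"
    by (simp add: inner_diff_right dot_square_norm power2_eq_square)
  finally show ?thesis
    using e z(2) by (smt (verit) mult_pos_pos zero_less_norm_iff)
qed

text \<open>This trades an interior direction for a decrease of the objective of P_2 by
  \<open>\<delta>\<close>.\<close>

lemma interior_cone_absorb:
  fixes C :: "'a::real_normed_vector set"
  assumes "d \<in> interior C"
  obtains \<delta> where "\<delta> > 0" "d - \<delta> *\<^sub>R c \<in> C"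
proof -
  obtain e where e: "e > 0" "cball d e \<subseteq> C"
    using assms mem_interior_cball by blast
  \<comment> \<open>The \<open>+ 1\<close> keeps the step length defined when
    \<open>c = 0\<close>.\<close>
  have "e * norm c / (norm c + 1) \<le> e"
    using e(1) add_nonneg_pos[OF norm_ge_zero[of c] zero_less_one]
    by (simp add: pos_divide_le_eq algebra_simps)
  then have "d - (e / (norm c + 1)) *\<^sub>R c \<in> C"
    using e(1) by (intro subsetD[OF e(2)]) (simp add: dist_norm abs_of_nonneg add.commute)
  then show thesis
    using e(1) by (intro that[of "e / (norm c + 1)"]) (simp_all add: add_nonneg_pos)
qed

subsection \<open>Vertices of sets contained in a translated pointed cone\<close>

text \<open>By homogeneity the minimum of the functional over the compact set of unit vectors in
  \<open>C\<close> serves as constant; if there are no such vectors, any positive constant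
  does.\<close>

lemma positive_functional_coercive:
  fixes C :: "'a::euclidean_space set"
  assumes "closed C" "convex_cone C" and pos: "\<And>d. d \<in> C \<Longrightarrow> d \<noteq> 0 \<Longrightarrow> 0 < w \<bullet> d"
  obtains \<mu> where "\<mu> > 0" "\<And>d. d \<in> C \<Longrightarrow> \<mu> * norm d \<le> w \<bullet> d"
proof (cases "C \<inter> sphere 0 1 = {}")
  case True
  have "d = 0" if "d \<in> C" for d
  proof (rule ccontr)
    assume "d \<noteq> 0"
    then have "inverse (norm d) *\<^sub>R d \<in> C \<inter> sphere 0 1"
      using that assms(2) by (auto intro: convex_cone_scaleR)
    with True show False
      by blast
  qed
  then have "1 * norm d \<le> w \<bullet> d" if "d \<in> C" for d
    using that by fastforce
  then show thesis
    by (intro that[of 1]) auto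
next
  case False
  have "compact (C \<inter> sphere 0 1)"
    using assms(1) by (intro closed_Int_compact) auto
  then obtain s where s: "s \<in> C \<inter> sphere 0 1" "\<And>y. y \<in> C \<inter> sphere 0 1 \<Longrightarrow> w \<bullet> s \<le> w \<bullet> y"
    using continuous_attains_inf[of "C \<inter> sphere 0 1" "\<lambda>x. w \<bullet> x"] False
      continuous_on_inner[OF continuous_on_const continuous_on_id]
    by metis
  show thesis
  proof (rule that)
    show "0 < w \<bullet> s"
      using s(1) by (intro pos) auto
    fix d assume d: "d \<in> C"
    show "w \<bullet> s * norm d \<le> w \<bullet> d"
    proof (cases "d = 0")
      case False
      then have "inverse (norm d) *\<^sub>R d \<in> C \<inter> sphere 0 1"
        using d assms(2) by (auto intro: convex_cone_scaleR)
      from s(2)[OF this] False show ?thesis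
        by (simp add: field_simps)
    qed simp
  qed
qed

text \<open>Coercivity makes sublevel sets in \<open>P\<close> compact, so the minimum is attained
  on a compact face; an extreme point of that face is one of \<open>P\<close>.\<close>

lemma positive_functional_attains_inf_at_extreme_point:
  fixes P C :: "'a::euclidean_space set"
  assumes "closed C" "convex_cone C" and pos: "\<And>d. d \<in> C \<Longrightarrow> d \<noteq> 0 \<Longrightarrow> 0 < w \<bullet> d"
    and P: "closed P" "convex P" "P \<noteq> {}" "\<And>y. y \<in> P \<Longrightarrow> y - a \<in> C"
  obtains v where "v extreme_point_of P" "\<And>y. y \<in> P \<Longrightarrow> w \<bullet> v \<le> w \<bullet> y"
proof -
  obtain \<mu> where \<mu>: "\<mu> > 0" "\<And>d. d \<in> C \<Longrightarrow> \<mu> * norm d \<le> w \<bullet> d"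
    using positive_functional_coercive[OF assms(1,2) pos] by blast
  obtain p where p: "p \<in> P"
    using P(3) by blast
  define S where "S = P \<inter> {x. w \<bullet> x \<le> w \<bullet> p}"
  have "norm x \<le> norm a + (w \<bullet> p - w \<bullet> a) / \<mu>" if "x \<in> S" for x
  proof -
    have "\<mu> * norm (x - a) \<le> w \<bullet> p - w \<bullet> a"
      using \<mu>(2)[OF P(4), of x] that by (auto simp: S_def inner_diff_right)
    then have "norm (x - a) \<le> (w \<bullet> p - w \<bullet> a) / \<mu>"
      using \<mu>(1) by (simp add: field_simps)
    then show ?thesis
      using norm_triangle_sub[of x a] by linarith
  qed
  then have "bounded S"
    by (auto simp: bounded_iff)
  then have "compact S"
    using P(1) by (auto simp: S_def compact_eq_bounded_closed closed_halfspace_le)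
  moreover have "p \<in> S"
    using p by (simp add: S_def)
  ultimately obtain s where s: "s \<in> S" "\<And>y. y \<in> S \<Longrightarrow> w \<bullet> s \<le> w \<bullet> y"
    using continuous_attains_inf[of S "\<lambda>x. w \<bullet> x"] continuous_on_inner[OF continuous_on_const continuous_on_id]
    by (metis empty_iff)
  have min: "w \<bullet> s \<le> w \<bullet> y" if "y \<in> P" for y
    using s(2)[of y] s(2)[OF \<open>p \<in> S\<close>] that by (cases "w \<bullet> y \<le> w \<bullet> p") (auto simp: S_def)
  define F where "F = P \<inter> {x. w \<bullet> x = w \<bullet> s}"
  have F: "F face_of P"
    unfolding F_def using P(2) min by (intro face_of_Int_supporting_hyperplane_ge) auto
  have "F \<subseteq> S" "s \<in> F"
    using s(1) by (auto simp: F_def S_def)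
  moreover have "closed F"
    unfolding F_def by (intro closed_Int P(1) closed_hyperplane)
  ultimately have "compact F"
    using \<open>bounded S\<close> bounded_subset compact_eq_bounded_closed by blast
  then obtain v where v: "v extreme_point_of F"
    using extreme_point_exists_convex[of F] face_of_imp_convex[OF F] \<open>s \<in> F\<close> by blast
  then have "v extreme_point_of P" "v \<in> F"
    using extreme_point_of_face[OF F] by auto
  with min that show thesis
    by (auto simp: F_def)
qed

text \<open>A point outside hull plus cone is strictly separated by some \<open>u\<close>, which is
  nonnegative on \<open>C\<close>. Adding a small multiple of \<open>w\<close> makes it positive, so
  its minimum over \<open>P\<close> is attained at a vertex, against the separation.\<close>

lemma subset_hull_extreme_points_plus_cone:
  fixes P C :: "'a::euclidean_space set"
  assumes C: "closed C" "convex_cone C" and pos: "\<And>d. d \<in> C \<Longrightarrow> d \<noteq> 0 \<Longrightarrow> 0 < w \<bullet> d"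
    and P: "closed P" "convex P" "\<And>y. y \<in> P \<Longrightarrow> y - a \<in> C"
    and fin: "finite {v. v extreme_point_of P}"
    and y: "y \<in> P"
  shows "\<exists>p\<in>convex hull {v. v extreme_point_of P}. y - p \<in> C"
proof (rule ccontr)
  assume contr: "\<not> ?thesis"
  define V where "V = {v. v extreme_point_of P}"
  define Q where "Q = (\<Union>p\<in>convex hull V. \<Union>d\<in>C. {p + d})"
  have "closed Q"
    unfolding Q_def using fin C(1)
    by (intro compact_closed_sums finite_imp_compact_convex_hull) (auto simp: V_def)
  moreover have "convex Q"
    unfolding Q_def using C(2) by (intro convex_sums) (auto simp: convex_cone_def)
  moreover have "y \<notin> Q"
    using contr by (force simp: Q_def V_def)
  ultimately obtain u b where ub: "u \<bullet> y < b" "\<And>x. x \<in> Q \<Longrightarrow> b < u \<bullet> x"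
    using separating_hyperplane_closed_point[of Q y] by blast
  have "P \<noteq> {}"
    using y by blast
  obtain v0 where v0: "v0 \<in> V"
    using positive_functional_attains_inf_at_extreme_point[OF C pos P(1,2) \<open>P \<noteq> {}\<close> P(3)]
    by (auto simp: V_def)
  have VQ: "v + d \<in> Q" if "v \<in> V" "d \<in> C" for v d
    using that hull_inc[of v V] by (auto simp: Q_def)
  have unonneg: "0 \<le> u \<bullet> d" if "d \<in> C" for d
  proof (rule ccontr)
    assume neg: "\<not> 0 \<le> u \<bullet> d"
    \<comment> \<open>Going this far from \<open>v0\<close> along \<open>d\<close> would bring
      \<open>u\<close> down to at most \<open>b\<close>.\<close>
    define s where "s = \<bar>b - u \<bullet> v0\<bar> / - (u \<bullet> d)"
    have "s \<ge> 0"
      using neg unfolding s_def by (intro divide_nonneg_pos) auto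
    then have "b < u \<bullet> (v0 + s *\<^sub>R d)"
      using that v0 by (intro ub VQ convex_cone_scaleR C)
    moreover have "s * (u \<bullet> d) = - \<bar>b - u \<bullet> v0\<bar>"
      using neg by (simp add: s_def)
    ultimately show False
      by (simp add: inner_add_right)
  qed
  define r where "r = w \<bullet> (y - a)"
  have "r \<ge> 0"
    using pos[OF P(3)[OF y]] unfolding r_def by (cases "y - a = 0") auto
  \<comment> \<open>The perturbation by \<open>\<delta>\<close> has to cost less than the separation
    gap at \<open>y\<close>; the \<open>+ 1\<close> gives strictness and covers
    \<open>r = 0\<close>.\<close>
  define \<delta> where "\<delta> = (b - u \<bullet> y) / (r + 1)"
  have \<delta>: "\<delta> > 0" "\<delta> * r < b - u \<bullet> y"
    using ub(1) \<open>r \<ge> 0\<close> by (auto simp: \<delta>_def field_simps)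
  have "0 < (u + \<delta> *\<^sub>R w) \<bullet> d" if "d \<in> C" "d \<noteq> 0" for d
    using unonneg[OF that(1)] pos[OF that] \<delta>(1) by (simp add: inner_add_left add_nonneg_pos)
  then obtain v where v: "v extreme_point_of P"
      and min: "\<And>y. y \<in> P \<Longrightarrow> (u + \<delta> *\<^sub>R w) \<bullet> v \<le> (u + \<delta> *\<^sub>R w) \<bullet> y"
    using positive_functional_attains_inf_at_extreme_point[OF C _ P(1,2) \<open>P \<noteq> {}\<close> P(3)] by metis
  have "v \<in> P"
    using v by (simp add: extreme_point_of_def)
  have "b < u \<bullet> v"
    using ub(2)[OF VQ[of v 0]] v convex_cone_contains_0[OF C(2)] by (simp add: V_def)
  moreover have "0 \<le> w \<bullet> (v - a)"
    using pos[OF P(3)[OF \<open>v \<in> P\<close>]] by (cases "v - a = 0") auto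
  then have "\<delta> * (w \<bullet> y - w \<bullet> v) \<le> \<delta> * r"
    using \<delta>(1) by (simp add: r_def inner_diff_right)
  ultimately show False
    using min[OF y] \<delta>(2) by (simp add: inner_add_left algebra_simps)
qed

subsection \<open>Primal and dual points of the scalar problems\<close>

lemma column_inner: "column j A \<bullet> y = (y v* A) $ j"
  for A :: "real^'j^'q"
  by (simp add: column_def inner_vec_def vector_matrix_mult_def mult.commute)

text \<open>\<open>columns T\<close> is a set, in which repeated columns would collapse; injectivity
  makes its cardinality the full dimension, so \<open>T\<close> has full rank.\<close>

lemma invertible_independent_columns:
  fixes T :: "real^'q^'q"
  assumes "inj (\<lambda>j. column j T)" "independent (columns T)"
  shows "invertible T"
proof -
  have "columns T = range (\<lambda>j. column j T)"
    by (auto simp: columns_def)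
  then have "rank T = CARD('q)"
    using assms by (simp add: column_rank_def dim_eq_card_independent card_image)
  then show ?thesis
    by (simp add: full_rank_injective invertible_left_inverse matrix_left_invertible_injective)
qed

section \<open>The problem data, normalized weights and scalar problems\<close>

locale approximation_setting =
  fixes C :: "'q::{finite,linorder} rvec set"
    and c :: "'q rvec"
    and T :: "('q rvec, 'q) vec"
    and X :: "(real^'n) set"
    and g :: "real^'n \<Rightarrow> real^'m"
    and \<Gamma> :: "real^'n \<Rightarrow> 'q rvec"
    and Z :: "(real^'j, 'q) vec"
    and Y :: "(real^'r, 'q) vec"
  assumes C_closed: "closed C"
    and C_convex_cone: "convex_cone C"
    and C_pointed: "\<not> contains_line C"
    and feasible_nonempty: "feasible_set X g \<noteq> {}"
    and feasible_compact: "compact (feasible_set X g)"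
    and Gamma_continuous: "continuous_on (feasible_set X g) \<Gamma>"
    and c_interior: "c \<in> interior C"
    and T_last_column: "column last_ix T = c"
    and T_invertible: "invertible T"
    and Z_generates: "columns_generate Z (dual_cone C)"
    and Z_normalized: "\<And>j. c \<bullet> column j Z = 1"
    and Y_generates: "columns_generate Y C"
begin

text \<open>These are exactly the vectors \<open>w_vec T t\<close> with \<open>t\<close> dual
  feasible.\<close>

definition weights :: "'q rvec set" where
  "weights = {w \<in> dual_cone C. w \<bullet> c = 1}"

text \<open>The optimal value of the weighted-sum problem P_1(w).\<close>

definition scalar_value :: "'q rvec \<Rightarrow> real" where
  "scalar_value w = (INF x\<in>feasible_set X g. w \<bullet> \<Gamma> x)"

definition outer :: "'q rvec set \<Rightarrow> 'q rvec set" where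
  "outer W = {y. \<forall>w\<in>W. scalar_value w \<le> w \<bullet> y}"

text \<open>Compactness and continuity bound the values from below, which is what makes the infimum
  on the reals meaningful.\<close>

lemma scalar_value_le:
  assumes "x \<in> feasible_set X g"
  shows "scalar_value w \<le> w \<bullet> \<Gamma> x"
proof -
  have "compact ((\<lambda>x. w \<bullet> \<Gamma> x) ` feasible_set X g)"
    by (intro compact_continuous_image continuous_intros Gamma_continuous feasible_compact)
  then have "bdd_below ((\<lambda>x. w \<bullet> \<Gamma> x) ` feasible_set X g)"
    by (intro bounded_imp_bdd_below compact_imp_bounded)
  then show ?thesis
    unfolding scalar_value_def using assms by (rule cINF_lower)
qed

lemma scalar_value_P1_optimal:
  assumes "P1_optimal X g \<Gamma> w x"
  shows "scalar_value w = w \<bullet> \<Gamma> x"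
proof (rule antisym)
  show "scalar_value w \<le> w \<bullet> \<Gamma> x"
    using assms by (auto simp: P1_optimal_def intro: scalar_value_le)
  show "w \<bullet> \<Gamma> x \<le> scalar_value w"
    unfolding scalar_value_def using assms feasible_nonempty
    by (intro cINF_greatest) (auto simp: P1_optimal_def)
qed

lemma weights_nonzero: "w \<in> weights \<Longrightarrow> w \<noteq> 0"
  by (auto simp: weights_def)

lemma column_Z_in_weights: "column j Z \<in> weights"
proof -
  have "column j Z \<in> dual_cone C"
    using Z_generates unfolding columns_generate_def
    by (auto intro!: exI[of _ "axis j 1"] simp: less_eq_vec_def matrix_vector_mult_basis[symmetric])
       (simp add: axis_def)
  then show ?thesis
    using Z_normalized by (simp add: weights_def inner_commute)
qed

text \<open>By the bipolar theorem, generators of the dual cone give an inequality description of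
  \<open>C\<close>.\<close>

lemma mem_C_iff: "y \<in> C \<longleftrightarrow> (\<forall>j. 0 \<le> column j Z \<bullet> y)"
proof
  assume "y \<in> C"
  then show "\<forall>j. 0 \<le> column j Z \<bullet> y"
    using column_Z_in_weights by (auto simp: weights_def dual_cone_def)
next
  assume y: "\<forall>j. 0 \<le> column j Z \<bullet> y"
  show "y \<in> C"
  proof (rule dual_cone_bipolar[OF C_closed C_convex_cone])
    fix z assume "z \<in> dual_cone C"
    then obtain l where l: "z = Z *v l" "0 \<le> l"
      using Z_generates by (auto simp: columns_generate_def)
    have "z \<bullet> y = (y v* Z) \<bullet> l"
      using dot_lmul_matrix[of y Z l] by (simp add: l inner_commute)
    also have "\<dots> = (\<Sum>j\<in>UNIV. (column j Z \<bullet> y) * l $ j)"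
      by (simp add: inner_vec_def[of "y v* Z"] column_inner)
    also have "\<dots> \<ge> 0"
      using y l(2) by (auto simp: less_eq_vec_def intro!: sum_nonneg)
    finally show "0 \<le> z \<bullet> y" .
  qed
qed

lemma scaleR_c_in_C: "0 \<le> s \<Longrightarrow> s *\<^sub>R c \<in> C"
  using c_interior interior_subset C_convex_cone by (auto intro: convex_cone_scaleR)

text \<open>The matrix inequality becomes the cone order: \<open>\<Gamma> x\<close> lies below
  \<open>v + z c\<close>.\<close>

lemma P2_feasible_iff:
  "P2_feasible c Z X g \<Gamma> v x z \<longleftrightarrow> x \<in> feasible_set X g \<and> v + z *\<^sub>R c - \<Gamma> x \<in> C"
proof -
  have "transpose Z *v (\<Gamma> x - z *\<^sub>R c - v) \<le> 0 \<longleftrightarrow>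
      (\<forall>j. column j Z \<bullet> (\<Gamma> x - z *\<^sub>R c - v) \<le> 0)"
    by (simp add: less_eq_vec_def column_inner)
  also have "\<dots> \<longleftrightarrow> v + z *\<^sub>R c - \<Gamma> x \<in> C"
    by (auto simp: mem_C_iff inner_diff_right inner_add_right algebra_simps)
  finally show ?thesis
    by (auto simp: P2_feasible_def feasible_set_def)
qed

text \<open>Nonnegativity on the generators of \<open>C\<close> extends to their nonnegative
  combinations; hence every dual point found by the algorithm comes from a weight.\<close>

lemma D2_feasible_imp_weight:
  assumes "D2_feasible c Y u w"
  shows "w \<in> weights"
proof -
  have "0 \<le> w \<bullet> y" if y: "y \<in> C" for y
  proof -
    obtain l where l: "y = Y *v l" "0 \<le> l"
      using Y_generates y unfolding columns_generate_def by blast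
    have "w \<bullet> y = (w v* Y) \<bullet> l"
      by (simp add: l dot_lmul_matrix)
    also have "\<dots> \<ge> 0"
      using assms l(2) by (auto simp: D2_feasible_def inner_vec_def less_eq_vec_def intro!: sum_nonneg)
    finally show ?thesis .
  qed
  then show ?thesis
    using assms by (auto simp: weights_def dual_cone_def D2_feasible_def)
qed

text \<open>A nonzero weight is strictly positive on the interior of \<open>C\<close>, so a strictly
  dominating value would have a smaller weighted sum.\<close>

lemma P1_optimal_imp_weak_minimizer:
  assumes "w \<in> weights" "P1_optimal X g \<Gamma> w x"
  shows "weak_minimizer C X g \<Gamma> x"
proof -
  have "\<Gamma> x - d \<noteq> \<Gamma> x'" if "d \<in> interior C" "x' \<in> feasible_set X g" for d x'
  proof
    assume eq: "\<Gamma> x - d = \<Gamma> x'"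
    have "0 < w \<bullet> d"
      using assms(1) that(1) weights_nonzero
      by (intro inner_interior_cone_pos) (auto simp: weights_def)
    moreover have "w \<bullet> \<Gamma> x \<le> w \<bullet> \<Gamma> x'"
      using assms(2) that(2) by (auto simp: P1_optimal_def)
    ultimately show False
      by (simp add: eq[symmetric] inner_diff_right)
  qed
  then show ?thesis
    using assms(2) by (fastforce simp: weak_minimizer_def P1_optimal_def)
qed

text \<open>If some \<open>x'\<close> strictly dominated \<open>x\<close>, the interior slack
  \<open>d\<close> would leave room to lower \<open>z\<close> by \<open>\<delta>\<close>.\<close>

lemma P2_optimal_imp_weak_minimizer:
  assumes "P2_optimal c Z X g \<Gamma> v x z"
  shows "weak_minimizer C X g \<Gamma> x"
proof -
  have feas: "x \<in> feasible_set X g" "v + z *\<^sub>R c - \<Gamma> x \<in> C"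
    using assms by (auto simp: P2_optimal_def P2_feasible_iff)
  have "\<Gamma> x - d \<noteq> \<Gamma> x'" if d: "d \<in> interior C" and x': "x' \<in> feasible_set X g" for d x'
  proof
    assume eq: "\<Gamma> x - d = \<Gamma> x'"
    obtain \<delta> where \<delta>: "\<delta> > 0" "d - \<delta> *\<^sub>R c \<in> C"
      using interior_cone_absorb[OF d] .
    have "(v + z *\<^sub>R c - \<Gamma> x) + (d - \<delta> *\<^sub>R c) \<in> C"
      by (intro convex_cone_add C_convex_cone feas \<delta>)
    also have "(v + z *\<^sub>R c - \<Gamma> x) + (d - \<delta> *\<^sub>R c) = v + (z - \<delta>) *\<^sub>R c - \<Gamma> x'"
      by (simp add: eq[symmetric] algebra_simps)
    finally have "P2_feasible c Z X g \<Gamma> v x' (z - \<delta>)"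
      using x' by (simp add: P2_feasible_iff)
    then have "z \<le> z - \<delta>"
      using assms by (auto simp: P2_optimal_def)
    with \<delta>(1) show False
      by simp
  qed
  then show ?thesis
    using feas(1) by (fastforce simp: weak_minimizer_def)
qed

section \<open>The correspondence between weights and dual variables\<close>

lemma w_vec_mult_T: "w_vec T t v* T = (\<chi> i. if i = last_ix then 1 else t $ i)"
  and mult_T_inv: "(w v* T) v* matrix_inv T = w"
  and inv_mult_T: "matrix_inv T *v (T *v y) = y"
proof -
  \<comment> \<open>\<open>matrix_inv\<close> is defined by choice, so its two-sided property comes
    from the existence of an inverse.\<close>
  have "T ** matrix_inv T = mat 1 \<and> matrix_inv T ** T = mat 1"
    using T_invertible unfolding matrix_inv_def invertible_def by (rule someI_ex)
  then show "w_vec T t v* T = (\<chi> i. if i = last_ix then 1 else t $ i)"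
    "(w v* T) v* matrix_inv T = w" "matrix_inv T *v (T *v y) = y"
    by (auto simp: w_vec_def vector_matrix_mul_assoc matrix_vector_mul_assoc)
qed

lemma w_vec_cong:
  assumes "\<And>i. i \<noteq> last_ix \<Longrightarrow> s $ i = t $ i"
  shows "w_vec T s = w_vec T t"
proof -
  have "(\<chi> i. if i = last_ix then 1 else s $ i) = (\<chi> i. if i = last_ix then 1 else t $ i)"
    using assms by (auto simp: vec_eq_iff)
  then show ?thesis
    unfolding w_vec_def by (rule arg_cong)
qed

lemma w_vec_inner_c: "w_vec T t \<bullet> c = 1"
proof -
  have "w_vec T t \<bullet> c = (w_vec T t v* T) $ last_ix"
    using T_last_column column_inner[of last_ix T "w_vec T t"] by (simp add: inner_commute)
  then show ?thesis
    by (simp add: w_vec_mult_T)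
qed

text \<open>Normalization makes the last coordinate of \<open>w v* T\<close> equal to 1, so
  \<open>w_vec\<close> overwrites it with its own value.\<close>

lemma w_vec_transpose_T:
  assumes "w \<bullet> c = 1"
  shows "w_vec T (transpose T *v w) = w"
proof -
  have "(w v* T) $ last_ix = 1"
    using T_last_column column_inner[of last_ix T w] assms by (simp add: inner_commute)
  then have "(\<chi> i. if i = last_ix then 1 else (w v* T) $ i) = w v* T"
    by (simp add: vec_eq_iff)
  then show ?thesis
    by (simp add: w_vec_def mult_T_inv)
qed

lemma coupling_dual_objective:
  "coupling T y (dual_objective T X g \<Gamma> t) = w_vec T t \<bullet> y - scalar_value (w_vec T t)"
proof -
  have "(\<chi> i. if i = last_ix then 1 else dual_objective T X g \<Gamma> t $ i) =
      (\<chi> i. if i = last_ix then 1 else t $ i)"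
    by (simp add: vec_eq_iff dual_objective_def)
  then have "coupling T y (dual_objective T X g \<Gamma> t) = w_vec T t \<bullet> y - dual_objective T X g \<Gamma> t $ last_ix"
    unfolding coupling_def w_vec_def by (rule arg_cong)
  then show ?thesis
    by (simp add: dual_objective_def scalar_value_def)
qed

text \<open>This translates the cuts of the algorithm into the form \<open>outer\<close>.\<close>

lemma coupling_cut:
  assumes "w \<in> weights"
  shows "{y. 0 \<le> coupling T y (dual_objective T X g \<Gamma> (transpose T *v w))} = outer {w}"
  using assms
  \<comment> \<open>The simp rule \<open>transpose_matrix_vector\<close> would rewrite
    \<open>transpose T *v w\<close>, and \<open>w_vec_transpose_T\<close> would no longer
    match.\<close>
  by (simp add: coupling_dual_objective w_vec_transpose_T weights_def outer_def del: transpose_matrix_vector)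

lemma dual_feasible_iff: "t \<in> dual_feasible_set C T \<longleftrightarrow> w_vec T t \<in> weights"
  by (simp add: dual_feasible_set_def weights_def w_vec_inner_c)

text \<open>The first \<open>q - 1\<close> coordinates of \<open>t\<close> determine \<open>w(t)\<close> and hence \<open>D\<^sup>*(t)\<close>, whereas \<open>K\<close> only
  moves the last one.\<close>

lemma dual_feasible_imp_maximizer:
  assumes "t \<in> dual_feasible_set C T"
  shows "dual_maximizer C T X g \<Gamma> t"
proof -
  have "dual_objective T X g \<Gamma> s = dual_objective T X g \<Gamma> t"
    if le: "le_cone dual_order_cone (dual_objective T X g \<Gamma> t) (dual_objective T X g \<Gamma> s)" for s
  proof -
    obtain r where r: "dual_objective T X g \<Gamma> s - dual_objective T X g \<Gamma> t = r *\<^sub>R axis last_ix 1"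
      using le by (auto simp: le_cone_def dual_order_cone_def)
    have eq: "s $ i = t $ i" if "i \<noteq> last_ix" for i
      using arg_cong[OF r, of "\<lambda>x. x $ i"] that by (simp add: dual_objective_def axis_def)
    then have "w_vec T s = w_vec T t"
      by (rule w_vec_cong)
    then have "dual_objective T X g \<Gamma> s $ i = dual_objective T X g \<Gamma> t $ i" for i
      using eq by (simp add: dual_objective_def)
    then show ?thesis
      by (simp add: vec_eq_iff)
  qed
  then show ?thesis
    using assms by (auto simp: dual_maximizer_def)
qed

subsection \<open>Outer approximations\<close>

lemma outer_Un: "outer (A \<union> B) = outer A \<inter> outer B"
  by (auto simp: outer_def)

lemma outer_insert: "outer (insert w W) = outer {w} \<inter> outer W"
  by (auto simp: outer_def)

lemma outer_empty: "outer {} = UNIV"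
  by (simp add: outer_def)

text \<open>Far enough along \<open>- c\<close> the constraint fails. Thus \<open>M = UNIV\<close>
  after a pass means that no cut was made.\<close>

lemma outer_weight_neq_UNIV:
  assumes "w \<in> weights"
  shows "outer {w} \<noteq> UNIV"
proof -
  have "(scalar_value w - 1) *\<^sub>R c \<notin> outer {w}"
    using assms by (simp add: outer_def weights_def)
  then show ?thesis
    by blast
qed

lemma closed_outer: "closed (outer W)" and convex_outer: "convex (outer W)"
proof -
  have "outer W = (\<Inter>w\<in>W. {y. w \<bullet> y \<ge> scalar_value w})"
    by (auto simp: outer_def)
  then show "closed (outer W)" "convex (outer W)"
    by (auto intro: convex_INT closed_halfspace_ge convex_halfspace_ge)
qed

lemma upper_image_subset_outer:
  assumes "W \<subseteq> weights"
  shows "upper_image C X g \<Gamma> \<subseteq> outer W"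
  unfolding upper_image_def
proof (rule closure_minimal[OF _ closed_outer])
  show "{a + b |a b. a \<in> \<Gamma> ` feasible_set X g \<and> b \<in> C} \<subseteq> outer W"
  proof clarify
    fix x b assume "x \<in> feasible_set X g" "b \<in> C"
    then have "scalar_value w \<le> w \<bullet> \<Gamma> x" "0 \<le> w \<bullet> b" if "w \<in> W" for w
      using that assms by (auto intro: scalar_value_le simp: weights_def dual_cone_def)
    then show "\<Gamma> x + b \<in> outer W"
      by (fastforce simp: outer_def inner_add_right)
  qed
qed

text \<open>Were the sum zero at \<open>d\<close>, every column would vanish there, and
  \<open>C\<close> would contain the line through 0 in direction \<open>d\<close>.\<close>

lemma sum_columns_positive:
  assumes "d \<in> C" "d \<noteq> 0"
  shows "0 < (\<Sum>j\<in>UNIV. column j Z) \<bullet> d"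
proof -
  have nonneg: "0 \<le> column j Z \<bullet> d" for j
    using assms(1) mem_C_iff by blast
  have "(\<Sum>j\<in>UNIV. column j Z \<bullet> d) \<noteq> 0"
  proof
    assume "(\<Sum>j\<in>UNIV. column j Z \<bullet> d) = 0"
    then have "column j Z \<bullet> d = 0" for j
      using nonneg by (simp add: sum_nonneg_eq_0_iff)
    then have "\<forall>r. 0 + r *\<^sub>R d \<in> C"
      by (simp add: mem_C_iff)
    then show False
      using C_pointed assms(2) unfolding contains_line_def by blast
  qed
  then show ?thesis
    using nonneg by (simp add: inner_sum_left sum_nonneg less_le)
qed

lemma outer_subset_hull_vertices_plus_C:
  assumes W: "range (\<lambda>j. column j Z) \<subseteq> W"
    and fin: "finite {v. v extreme_point_of outer W}" and y: "y \<in> outer W"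
  shows "\<exists>p\<in>convex hull {v. v extreme_point_of outer W}. y - p \<in> C"
proof (rule subset_hull_extreme_points_plus_cone[where w = "\<Sum>j\<in>UNIV. column j Z"])
  \<comment> \<open>\<open>\<mu>\<close> dominates all initial bounds, so \<open>- \<mu> c\<close>
    is a lower bound of \<open>outer W\<close> in the cone order.\<close>
  define \<mu> where "\<mu> = (\<Sum>j\<in>UNIV. \<bar>scalar_value (column j Z)\<bar>)"
  show "y - (- \<mu>) *\<^sub>R c \<in> C" if "y \<in> outer W" for y
    unfolding mem_C_iff
  proof
    fix j
    have "- \<bar>scalar_value (column j Z)\<bar> \<le> column j Z \<bullet> y"
      using that W unfolding outer_def by (auto dest!: bspec[where x = "column j Z"])
    moreover have "\<bar>scalar_value (column j Z)\<bar> \<le> \<mu>"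
      unfolding \<mu>_def by (rule member_le_sum) auto
    ultimately show "0 \<le> column j Z \<bullet> (y - (- \<mu>) *\<^sub>R c)"
      using Z_normalized by (simp add: inner_add_right inner_commute)
  qed
qed (use C_closed C_convex_cone sum_columns_positive closed_outer convex_outer fin y in auto)

text \<open>The points covered up to \<open>\<epsilon>\<close> form a convex set \<open>S\<close>;
  containing the vertices, it contains their hull, and adding elements of \<open>C\<close> preserves
  coverage.\<close>

lemma outer_subset_hull_image_plus_C:
  assumes W: "range (\<lambda>j. column j Z) \<subseteq> W"
    and fin: "finite {v. v extreme_point_of outer W}"
    and vertex: "\<And>v. v extreme_point_of outer W \<Longrightarrow> \<exists>x\<in>A. v + \<epsilon> *\<^sub>R c - \<Gamma> x \<in> C"
    and y: "y \<in> outer W"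
  shows "\<exists>a\<in>convex hull (\<Gamma> ` A). y + \<epsilon> *\<^sub>R c - a \<in> C"
proof -
  define S where "S = {p. \<exists>a\<in>convex hull (\<Gamma> ` A). p + \<epsilon> *\<^sub>R c - a \<in> C}"
  have "convex S"
  proof (rule convexI)
    fix p p' and u v :: real
    assume "p \<in> S" "p' \<in> S" and uv: "0 \<le> u" "0 \<le> v" "u + v = 1"
    then obtain a a' where a: "a \<in> convex hull (\<Gamma> ` A)" "p + \<epsilon> *\<^sub>R c - a \<in> C"
        "a' \<in> convex hull (\<Gamma> ` A)" "p' + \<epsilon> *\<^sub>R c - a' \<in> C"
      by (auto simp: S_def)
    have "u *\<^sub>R (p + \<epsilon> *\<^sub>R c - a) + v *\<^sub>R (p' + \<epsilon> *\<^sub>R c - a') \<in> C"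
      using a uv C_convex_cone by (auto intro: convex_cone_add convex_cone_scaleR)
    also have "u *\<^sub>R (p + \<epsilon> *\<^sub>R c - a) + v *\<^sub>R (p' + \<epsilon> *\<^sub>R c - a') =
        (u *\<^sub>R p + v *\<^sub>R p') + ((u + v) * \<epsilon>) *\<^sub>R c - (u *\<^sub>R a + v *\<^sub>R a')"
      by (simp add: algebra_simps)
    finally show "u *\<^sub>R p + v *\<^sub>R p' \<in> S"
      using uv convexD[OF convex_convex_hull a(1,3) uv] by (auto simp: S_def)
  qed
  moreover have "{v. v extreme_point_of outer W} \<subseteq> S"
    using vertex by (fastforce simp: S_def intro: hull_inc)
  ultimately have "convex hull {v. v extreme_point_of outer W} \<subseteq> S"
    by (intro hull_minimal)
  then obtain p a where "y - p \<in> C" "a \<in> convex hull (\<Gamma> ` A)" "p + \<epsilon> *\<^sub>R c - a \<in> C"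
    using outer_subset_hull_vertices_plus_C[OF W fin y] by (fastforce simp: S_def)
  moreover from this have "(y - p) + (p + \<epsilon> *\<^sub>R c - a) \<in> C"
    using C_convex_cone by (intro convex_cone_add)
  ultimately show ?thesis
    by (intro bexI[of _ a]) (simp_all add: algebra_simps)
qed

subsection \<open>Covering the lower image\<close>

text \<open>The affine functions with slope \<open>-1\<close> in the last coordinate are exactly those of the form
  \<open>\<phi>(y, \<cdot>)\<close>.\<close>

lemma coupling_represents:
  assumes "\<alpha> $ last_ix = - 1"
  obtains y where "\<And>t. coupling T y t = \<alpha> \<bullet> t - r"
proof
  \<comment> \<open>Multiplying by \<open>T\<close> cancels the inverse in \<open>coupling\<close>,
    so the coordinates of \<open>?\<eta>\<close> are the desired slopes and offset.\<close>
  let ?\<eta> = "\<chi> i. if i = last_ix then - r else \<alpha> $ i"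
  fix t :: "'q rvec"
  have "coupling T (T *v ?\<eta>) t = (\<chi> i. if i = last_ix then 1 else t $ i) \<bullet> ?\<eta> - t $ last_ix"
    by (simp add: coupling_def dot_lmul_matrix inv_mult_T)
  also have "(\<chi> i. if i = last_ix then 1 else t $ i) \<bullet> ?\<eta> = - r + (\<Sum>i\<in>UNIV - {last_ix}. \<alpha> $ i * t $ i)"
    by (simp add: inner_vec_def sum.remove[of UNIV last_ix] mult.commute)
  also have "(\<Sum>i\<in>UNIV - {last_ix}. \<alpha> $ i * t $ i) = \<alpha> \<bullet> t + t $ last_ix"
    using assms by (simp add: inner_vec_def sum.remove[of UNIV last_ix])
  finally show "coupling T (T *v ?\<eta>) t = \<alpha> \<bullet> t - r"
    by simp
qed

lemma lower_image_covered:
  assumes B: "finite B" "B \<noteq> {}" "B \<subseteq> weights"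
    and A: "A \<subseteq> feasible_set X g"
    and cover: "\<And>y. y \<in> outer B \<Longrightarrow> \<exists>a\<in>convex hull (\<Gamma> ` A). y + \<epsilon> *\<^sub>R c - a \<in> C"
    and t: "t \<in> lower_image C T X g \<Gamma>"
  shows "t \<in> {a - b + \<epsilon> *\<^sub>R axis last_ix 1 |a b.
      a \<in> convex hull (dual_objective T X g \<Gamma> ` (\<lambda>w. transpose T *v w) ` B) \<and> b \<in> dual_order_cone}"
proof (rule ccontr)
  assume contr: "\<not> ?thesis"
  define D where "D w = dual_objective T X g \<Gamma> (transpose T *v w)" for w
  define H where "H = convex hull (D ` B)"
  \<comment> \<open>This is \<open>- K\<close>, written in coordinates so that closedness and
    convexity can be read off.\<close>
  define N where "N = {x :: 'q rvec. x $ last_ix \<le> 0 \<and> (\<forall>i. i \<noteq> last_ix \<longrightarrow> x $ i = 0)}"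
  define s where "s = t - \<epsilon> *\<^sub>R axis last_ix 1"
  define Q where "Q = (\<Union>a\<in>H. \<Union>b\<in>N. {a + b})"
  have N: "- b \<in> dual_order_cone" if "b \<in> N" for b
  proof -
    have "- b = (- b $ last_ix) *\<^sub>R axis last_ix 1"
      using that by (auto simp: vec_eq_iff N_def axis_def)
    then show ?thesis
      using that unfolding dual_order_cone_def N_def
      by (intro CollectI exI[of _ "- b $ last_ix"]) auto
  qed
  have "s \<notin> Q"
  proof
    assume "s \<in> Q"
    then obtain a b where ab: "a \<in> H" "b \<in> N" "s = a + b"
      by (auto simp: Q_def)
    then have "t = a - (- b) + \<epsilon> *\<^sub>R axis last_ix 1"
      by (simp add: s_def algebra_simps)
    with ab N contr show False
      unfolding H_def D_def image_image by blast
  qed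
  moreover have "closed Q"
    unfolding Q_def
  proof (rule compact_closed_sums)
    show "compact H"
      unfolding H_def using B(1) by (intro finite_imp_compact_convex_hull) auto
    show "closed N"
      unfolding N_def by (intro closed_Collect_conj closed_Collect_all closed_Collect_imp
          closed_Collect_le closed_Collect_eq open_Collect_const continuous_intros)
  qed
  moreover have "convex Q"
    unfolding Q_def
  proof (rule convex_sums)
    show "convex N"
      by (rule convexI) (auto simp: N_def intro!: add_nonpos_nonpos mult_nonneg_nonpos)
  qed (simp add: H_def)
  ultimately obtain a b where ab: "a \<bullet> s < b" "\<And>x. x \<in> Q \<Longrightarrow> b < a \<bullet> x"
    using separating_hyperplane_closed_point[of Q s] by blast
  have DQ: "D w + r *\<^sub>R axis last_ix 1 \<in> Q" if "w \<in> B" "r \<le> 0" for w r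
    using that by (auto simp: Q_def H_def N_def axis_def intro!: bexI[of _ "D w"] hull_inc)
  \<comment> \<open>\<open>Q\<close> is unbounded downwards in the last coordinate, while
    \<open>a\<close> is bounded below on it.\<close>
  have "a $ last_ix \<le> 0"
  proof (rule ccontr)
    assume pos: "\<not> a $ last_ix \<le> 0"
    obtain w where w: "w \<in> B"
      using B(2) by blast
    define r where "r = - \<bar>b - a \<bullet> D w\<bar> / a $ last_ix"
    have "r \<le> 0"
      using pos by (simp add: r_def divide_nonpos_pos)
    then have "b < a \<bullet> (D w + r *\<^sub>R axis last_ix 1)"
      using w by (intro ab(2) DQ)
    then show False
      using pos by (simp add: r_def inner_diff_right inner_axis)
  qed
  \<comment> \<open>An upper bound for the last coordinates of all \<open>D w\<close>; it controls
    the effect of the tilt on them.\<close>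
  define m where "m = (\<Sum>w\<in>B. \<bar>scalar_value w\<bar>)"
  have m: "scalar_value w \<le> m" if "w \<in> B" for w
    using member_le_sum[of w B "\<lambda>w. \<bar>scalar_value w\<bar>"] B(1) that by (simp add: m_def)
  \<comment> \<open>The tilt makes the last slope strictly negative, yet is small enough to keep
    \<open>s\<close> strictly separated.\<close>
  define \<delta> where "\<delta> = (b - a \<bullet> s) / (\<bar>m - s $ last_ix\<bar> + 1)"
  have \<delta>: "\<delta> > 0"
    using ab(1) by (auto simp: \<delta>_def intro!: divide_pos_pos)
  have "\<delta> * (m - s $ last_ix) \<le> \<delta> * \<bar>m - s $ last_ix\<bar>"
    using \<delta> by simp
  also have "\<dots> < \<delta> * (\<bar>m - s $ last_ix\<bar> + 1)"
    using \<delta> by simp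
  also have "\<dots> = b - a \<bullet> s"
    by (simp add: \<delta>_def)
  finally have \<delta>': "\<delta> * (m - s $ last_ix) < b - a \<bullet> s" .
  define \<kappa> where "\<kappa> = \<delta> - a $ last_ix"
  have "\<kappa> > 0"
    using \<delta> \<open>a $ last_ix \<le> 0\<close> by (simp add: \<kappa>_def)
  \<comment> \<open>Dividing by \<open>\<kappa>\<close> normalizes the last slope to
    \<open>- 1\<close>, as \<open>coupling_represents\<close> requires.\<close>
  define \<alpha> where "\<alpha> = (1 / \<kappa>) *\<^sub>R (a - \<delta> *\<^sub>R axis last_ix 1)"
  have "\<alpha> $ last_ix = - 1"
    using \<open>\<kappa> > 0\<close> by (simp add: \<alpha>_def field_simps) (simp add: \<kappa>_def)
  then obtain y where y: "\<And>t. coupling T y t = \<alpha> \<bullet> t - (b - \<delta> * m) / \<kappa>"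
    using coupling_represents by blast
  have \<alpha>: "\<alpha> \<bullet> x = (a \<bullet> x - \<delta> * x $ last_ix) / \<kappa>" for x
    by (simp add: \<alpha>_def inner_diff_left inner_axis' )
  \<comment> \<open>Separation from the points \<open>D w\<close> says exactly that \<open>y\<close>
    satisfies the constraints of \<open>outer B\<close>, so the primal cover applies to
    \<open>y\<close>.\<close>
  have "scalar_value w \<le> w \<bullet> y" if w: "w \<in> B" for w
  proof -
    have wv: "w_vec T (transpose T *v w) = w"
      using w B(3) by (intro w_vec_transpose_T) (auto simp: weights_def)
    have "D w $ last_ix = scalar_value w"
      by (simp add: D_def dual_objective_def scalar_value_def wv[simplified])
    moreover have "\<delta> * scalar_value w \<le> \<delta> * m"
      using m[OF w] \<delta> by simp
    moreover have "b < a \<bullet> D w"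
      using ab(2)[OF DQ[OF w order_refl]] by simp
    ultimately have "a \<bullet> D w - \<delta> * D w $ last_ix \<ge> b - \<delta> * m"
      by simp
    then have "0 \<le> coupling T y (D w)"
      using \<open>\<kappa> > 0\<close> by (simp add: y \<alpha> divide_right_mono)
    then show ?thesis
      by (simp add: D_def coupling_dual_objective wv del: transpose_matrix_vector)
  qed
  then obtain p where p: "p \<in> convex hull (\<Gamma> ` A)" "y + \<epsilon> *\<^sub>R c - p \<in> C"
    using cover[of y] by (auto simp: outer_def)
  have t': "w_vec T t \<in> dual_cone C" "t $ last_ix \<le> scalar_value (w_vec T t)"
    using t by (auto simp: lower_image_def scalar_value_def)
  have "convex hull (\<Gamma> ` A) \<subseteq> {p. scalar_value (w_vec T t) \<le> w_vec T t \<bullet> p}"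
    using A by (intro hull_minimal convex_halfspace_ge) (auto intro: scalar_value_le)
  then have "t $ last_ix \<le> w_vec T t \<bullet> p"
    using p(1) t'(2) by force
  also have "\<dots> \<le> w_vec T t \<bullet> y + \<epsilon>"
    using p(2) t'(1) w_vec_inner_c[of t]
    by (auto simp: dual_cone_def inner_diff_right inner_add_right dest!: bspec)
  finally have "0 \<le> w_vec T t \<bullet> y - s $ last_ix"
    by (simp add: s_def axis_def)
  \<comment> \<open>\<open>s\<close> and \<open>t\<close> differ only in the last coordinate, so the
    bound obtained for \<open>t\<close> makes the coupling at \<open>s\<close> nonnegative, against
    the separation.\<close>
  also have "w_vec T t = w_vec T s"
    by (rule w_vec_cong) (simp add: s_def axis_def)
  also have "w_vec T s \<bullet> y - s $ last_ix = coupling T y s"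
    by (simp add: coupling_def w_vec_def)
  also have "\<dots> < 0"
    using \<delta>' \<open>\<kappa> > 0\<close> by (simp add: y \<alpha> divide_strict_right_mono algebra_simps)
  finally show False
    by simp
qed

subsection \<open>Correctness of the algorithm\<close>

text \<open>\<open>A\<close> and \<open>B\<close> describe the points added in the pass,
  \<open>W\<close> the weights that actually cut. Coverage of all vertices is claimed only for empty
  \<open>W\<close>, which rules out a break with unvisited vertices.\<close>

lemma vertex_loop_invariant:
  assumes "vertex_loop brk \<epsilon> c T Z Y X g \<Gamma> vs M Xb Tb M' Xb' Tb'"
  shows "\<exists>A B W. finite A \<and> (\<forall>x\<in>A. weak_minimizer C X g \<Gamma> x) \<and> Xb' = A \<union> Xb \<and>
    finite B \<and> B \<subseteq> weights \<and> Tb' = (\<lambda>w. transpose T *v w) ` B \<union> Tb \<and>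
    W \<subseteq> B \<and> M' = M \<inter> outer W \<and>
    (W = {} \<longrightarrow> (\<forall>v\<in>set vs. \<exists>x\<in>A. v + \<epsilon> *\<^sub>R c - \<Gamma> x \<in> C))"
  using assms
proof induction
  case (all_visited M Xb Tb)
  show ?case
    by (rule exI[of _ "{}"])+ (simp add: outer_empty)
next
  case (no_cut v x z u w vs M Xb Tb M' Xb' Tb')
  then obtain A B W where *: "finite A" "\<forall>x\<in>A. weak_minimizer C X g \<Gamma> x" "Xb' = A \<union> insert x Xb"
      "finite B" "B \<subseteq> weights" "Tb' = (\<lambda>w. transpose T *v w) ` B \<union> insert (transpose T *v w) Tb"
      "W \<subseteq> B" "M' = M \<inter> outer W"
      "W = {} \<longrightarrow> (\<forall>v\<in>set vs. \<exists>x\<in>A. v + \<epsilon> *\<^sub>R c - \<Gamma> x \<in> C)"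
    by blast
  have "w \<in> weights" "weak_minimizer C X g \<Gamma> x"
    using no_cut P2_optimal_imp_weak_minimizer by (auto simp: D2_optimal_def intro: D2_feasible_imp_weight)
  \<comment> \<open>Without a cut \<open>z\<close> is at most \<open>\<epsilon>\<close>, so the
    difference times \<open>c\<close> lies in \<open>C\<close>.\<close>
  moreover have "(v + z *\<^sub>R c - \<Gamma> x) + (\<epsilon> - z) *\<^sub>R c \<in> C"
    using no_cut by (intro convex_cone_add C_convex_cone scaleR_c_in_C) (auto simp: P2_optimal_def P2_feasible_iff)
  then have "v + \<epsilon> *\<^sub>R c - \<Gamma> x \<in> C"
    by (simp add: algebra_simps)
  ultimately show ?case
    using * by (intro exI[of _ "insert x A"] exI[of _ "insert w B"] exI[of _ W]) auto
next
  case (cut_continue v x z u w vs M Xb Tb M' Xb' Tb')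
  then obtain A B W where *: "finite A" "\<forall>x\<in>A. weak_minimizer C X g \<Gamma> x" "Xb' = A \<union> insert x Xb"
      "finite B" "B \<subseteq> weights" "Tb' = (\<lambda>w. transpose T *v w) ` B \<union> insert (transpose T *v w) Tb"
      "W \<subseteq> B" "M' = M \<inter> {y. coupling T y (dual_objective T X g \<Gamma> (transpose T *v w)) \<ge> 0} \<inter> outer W"
    by blast
  have "w \<in> weights" "weak_minimizer C X g \<Gamma> x"
    using cut_continue P2_optimal_imp_weak_minimizer
    by (auto simp: D2_optimal_def intro: D2_feasible_imp_weight)
  then show ?case
    using * by (intro exI[of _ "insert x A"] exI[of _ "insert w B"] exI[of _ "insert w W"])
      (auto simp: coupling_cut outer_insert[of w W] simp del: transpose_matrix_vector)
next
  case (cut_break v x z u w vs M Xb Tb)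
  have "w \<in> weights" "weak_minimizer C X g \<Gamma> x"
    using cut_break P2_optimal_imp_weak_minimizer
    by (auto simp: D2_optimal_def intro: D2_feasible_imp_weight)
  then show ?case
    \<comment> \<open>The witness \<open>{w}\<close> serves for both \<open>B\<close> and
      \<open>W\<close>; since \<open>W\<close> is nonempty, the claim on vertices is
      vacuous.\<close>
    by (intro exI[of _ "{x}"] exI[of _ "{w}"]) (auto simp: coupling_cut simp del: transpose_matrix_vector)
qed

text \<open>\<open>W\<close> holds the weights that define \<open>P\<close>, while \<open>B\<close>
  also holds those from vertices without a cut. The columns of \<open>Z\<close> stay in
  \<open>W\<close>, which keeps \<open>P\<close> in a translate of \<open>C\<close>.\<close>

lemma paa_state_invariant:
  assumes "paa_state brk \<epsilon> c T Z Y X g \<Gamma> k P Xb Tb"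
  shows "finite Xb \<and> Xb \<noteq> {} \<and> (\<forall>x\<in>Xb. weak_minimizer C X g \<Gamma> x) \<and>
    (\<exists>B W. finite B \<and> B \<subseteq> weights \<and> Tb = (\<lambda>w. transpose T *v w) ` B \<and>
      range (\<lambda>j. column j Z) \<subseteq> W \<and> W \<subseteq> B \<and> P = outer W)"
  using assms
proof induction
  case (init xs)
  let ?W = "range (\<lambda>j. column j Z)"
  have "(\<Inter>j. {y. column j Z \<bullet> y \<ge> column j Z \<bullet> \<Gamma> (xs j)}) = outer ?W"
    by (auto simp: outer_def scalar_value_P1_optimal[OF init])
  moreover have "weak_minimizer C X g \<Gamma> (xs j)" for j
    using P1_optimal_imp_weak_minimizer[OF column_Z_in_weights init] .
  moreover have "?W \<subseteq> weights"
    using column_Z_in_weights by blast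
  ultimately show ?case
    by (intro conjI exI[of _ ?W]) (auto simp: image_image)
next
  case (step k P Xb Tb vs M Xb' Tb')
  obtain A B W where *: "finite A" "\<forall>x\<in>A. weak_minimizer C X g \<Gamma> x" "Xb' = A \<union> Xb"
      "finite B" "B \<subseteq> weights" "Tb' = (\<lambda>w. transpose T *v w) ` B \<union> Tb" "W \<subseteq> B" "M = UNIV \<inter> outer W"
    using vertex_loop_invariant[OF step(3)] by blast
  obtain B0 W0 where **: "finite B0" "B0 \<subseteq> weights" "Tb = (\<lambda>w. transpose T *v w) ` B0"
      "range (\<lambda>j. column j Z) \<subseteq> W0" "W0 \<subseteq> B0" "P = outer W0"
    using step.IH by blast
  show ?case
    using step.IH * **
    by (intro conjI exI[of _ "B \<union> B0"] exI[of _ "W \<union> W0"]) (auto simp: outer_Un image_Un)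
qed

theorem paa_correct:
  assumes "paa_returns brk \<epsilon> c T Z Y X g \<Gamma> Xb' Tb'"
  shows "finite_weak_eps_solution C c X g \<Gamma> \<epsilon> Xb' \<and> finite_dual_eps_solution C T X g \<Gamma> \<epsilon> Tb'"
proof -
  obtain k P Xb Tb vs where state: "paa_state brk \<epsilon> c T Z Y X g \<Gamma> k P Xb Tb"
      and vs: "vertex_enumeration P vs"
      and loop: "vertex_loop brk \<epsilon> c T Z Y X g \<Gamma> vs UNIV Xb Tb UNIV Xb' Tb'"
    using assms by (auto simp: paa_returns_def)
  obtain B0 W0 where state': "finite Xb" "Xb \<noteq> {}" "\<forall>x\<in>Xb. weak_minimizer C X g \<Gamma> x"
      "finite B0" "B0 \<subseteq> weights" "Tb = (\<lambda>w. transpose T *v w) ` B0"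
      "range (\<lambda>j. column j Z) \<subseteq> W0" "W0 \<subseteq> B0" "P = outer W0"
    using paa_state_invariant[OF state] by blast
  obtain A B1 W where loop': "finite A" "\<forall>x\<in>A. weak_minimizer C X g \<Gamma> x" "Xb' = A \<union> Xb"
      "finite B1" "B1 \<subseteq> weights" "Tb' = (\<lambda>w. transpose T *v w) ` B1 \<union> Tb"
      "W \<subseteq> B1" "UNIV = UNIV \<inter> outer W"
      "W = {} \<longrightarrow> (\<forall>v\<in>set vs. \<exists>x\<in>A. v + \<epsilon> *\<^sub>R c - \<Gamma> x \<in> C)"
    using vertex_loop_invariant[OF loop] by blast
  have "W = {}"
  proof (rule ccontr)
    assume "W \<noteq> {}"
    then obtain w where w: "w \<in> W" by blast
    then have "outer W \<subseteq> outer {w}"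
      by (auto simp: outer_def)
    moreover have "outer {w} \<noteq> UNIV"
      using w loop' outer_weight_neq_UNIV by blast
    ultimately show False
      using loop'(8) by auto
  qed
  have V: "{v. v extreme_point_of P} = set vs"
    using vs by (simp add: vertex_enumeration_def)
  have cover: "\<exists>a\<in>convex hull (\<Gamma> ` Xb'). y + \<epsilon> *\<^sub>R c - a \<in> C" if "y \<in> P" for y
  proof -
    have "\<exists>x\<in>Xb'. v + \<epsilon> *\<^sub>R c - \<Gamma> x \<in> C" if "v extreme_point_of P" for v
      using that V loop'(3,9) \<open>W = {}\<close> by blast
    moreover have "finite {v. v extreme_point_of P}"
      using V by simp
    ultimately show ?thesis
      using outer_subset_hull_image_plus_C[OF state'(7)] that unfolding state'(9) by blast
  qed
  have Xb': "finite Xb'" "Xb' \<noteq> {}" "\<forall>x\<in>Xb'. weak_minimizer C X g \<Gamma> x"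
    using state' loop' by auto
  then have feas: "Xb' \<subseteq> feasible_set X g"
    by (auto simp: weak_minimizer_def)
  have "upper_image C X g \<Gamma> \<subseteq> {a + b - \<epsilon> *\<^sub>R c |a b. a \<in> convex hull (\<Gamma> ` Xb') \<and> b \<in> C}"
  proof
    fix y assume "y \<in> upper_image C X g \<Gamma>"
    then have "y \<in> P"
      using upper_image_subset_outer[of W0] state' by blast
    then obtain a where "a \<in> convex hull (\<Gamma> ` Xb')" "y + \<epsilon> *\<^sub>R c - a \<in> C"
      using cover by blast
    then show "y \<in> {a + b - \<epsilon> *\<^sub>R c |a b. a \<in> convex hull (\<Gamma> ` Xb') \<and> b \<in> C}"
      by (intro CollectI exI[of _ a] exI[of _ "y + \<epsilon> *\<^sub>R c - a"]) simp
  qed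
  then have primal: "finite_weak_eps_solution C c X g \<Gamma> \<epsilon> Xb'"
    using Xb' feas by (simp add: finite_weak_eps_solution_def)
  define B where "B = B1 \<union> B0"
  have B: "finite B" "B \<subseteq> weights" "W0 \<subseteq> B" "Tb' = (\<lambda>w. transpose T *v w) ` B"
    using state' loop' by (auto simp: B_def image_Un)
  have "B \<noteq> {}"
    using B(3) state'(7) by auto
  \<comment> \<open>The weights in \<open>B\<close> beyond \<open>W0\<close> only add constraints,
    so the cover of \<open>P\<close> also covers \<open>outer B\<close>.\<close>
  have "outer B \<subseteq> P"
    using B(3) state'(9) by (auto simp: outer_def)
  then have "lower_image C T X g \<Gamma> \<subseteq> {a - b + \<epsilon> *\<^sub>R axis last_ix 1 |a b.
      a \<in> convex hull (dual_objective T X g \<Gamma> ` Tb') \<and> b \<in> dual_order_cone}"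
    unfolding B(4) using lower_image_covered[OF B(1) \<open>B \<noteq> {}\<close> B(2) feas] cover by blast
  moreover have "Tb' \<subseteq> dual_feasible_set C T"
  proof -
    have "transpose T *v w \<in> dual_feasible_set C T" if "w \<in> B" for w
      using w_vec_transpose_T[of w] that B(2) unfolding dual_feasible_iff by (auto simp: weights_def)
    then show ?thesis
      using B(4) by blast
  qed
  ultimately have "finite_dual_eps_solution C T X g \<Gamma> \<epsilon> Tb'"
    unfolding finite_dual_eps_solution_def using B \<open>B \<noteq> {}\<close> dual_feasible_imp_maximizer by blast
  with primal show ?thesis ..
qed

end

theorem theorem4p9:
  fixes C :: "'q::{finite,linorder} rvec set"
    and c :: "'q rvec"
    and T :: "('q rvec, 'q) vec"
    and X :: "(real^'n) set"
    and g :: "real^'n \<Rightarrow> real^'m"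
    and \<Gamma> :: "real^'n \<Rightarrow> 'q rvec"
    and Z :: "(real^'j, 'q) vec"
    and Y :: "(real^'r, 'q) vec"
    and \<epsilon> :: real
    and brk :: bool
    and Xb :: "(real^'n) set"
    and Tb :: "'q rvec set"
  assumes C_polyhedral: "polyhedron C"
    and C_convex_cone: "convex_cone C"
    and C_nontrivial: "{0} \<subset> C" "C \<subset> UNIV"
    and C_pointed: "\<not> contains_line C"
    and C_interior: "interior C \<noteq> {}"
    and X_convex: "convex X"
    and Gamma_convex: "cone_convex_on C X \<Gamma>"
    and g_convex: "\<And>i. convex_on X (\<lambda>x. g x $ i)"
    and feasible_nonempty: "feasible_set X g \<noteq> {}"
    and feasible_compact: "compact (feasible_set X g)"
    and feasible_interior: "interior (feasible_set X g) \<noteq> {}"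
    and Gamma_continuous: "continuous_on X \<Gamma>"
    and c_interior: "c \<in> interior C"
    and T_last_column: "column last_ix T = c"
    and T_independent: "inj (\<lambda>j. column j T)" "independent (columns T)"
    and Z_generates: "columns_generate Z (dual_cone C)"
    and Z_normalized: "\<And>j. c \<bullet> column j Z = 1"
    and Y_generates: "columns_generate Y C"
    and eps_pos: "\<epsilon> > 0"
    and returned: "paa_returns brk \<epsilon> c T Z Y X g \<Gamma> Xb Tb"
  shows "finite_weak_eps_solution C c X g \<Gamma> \<epsilon> Xb \<and>
         finite_dual_eps_solution C T X g \<Gamma> \<epsilon> Tb"
proof -
  have "continuous_on (feasible_set X g) \<Gamma>"
    using Gamma_continuous by (rule continuous_on_subset) (auto simp: feasible_set_def)
  \<comment> \<open>Polyhedrality gives closedness of \<open>C\<close>, and independence of the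
    columns gives invertibility of \<open>T\<close>.\<close>
  then interpret approximation_setting C c T X g \<Gamma> Z Y
    using assms by unfold_locales (auto intro: polyhedron_imp_closed invertible_independent_columns)
  show ?thesis
    using returned by (rule paa_correct)
qed

end
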